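(* The horizontal displacement on the Stern-Brocot tree, starting at the root $1$ and moving from left to right on each level, corresponds to clockwise motion along Ford circles. More precisely, suppose the motion, started at the root, has reached $x=r_m$, the $m$-th element of the tree, with $\mathrm{depth}(x)=n$. Then the move to the next element $y=r_{m+1}$ corresponds to the following displacement (via horocyclic flow) on Ford circles: - if $x$ is the rightmost element in a level, i.e. $m=2^n-1$, then moving to $y$ corresponds to applying $A^{n-1}D^n$ for $n$ even, and $D^{n-1}A^n$ for $n$ odd; - if, instead, $x$ is either the leftmost or an inner element in a level, i.e. $m=2^{n-1}+(k-1)$ for some $1\le k<2^{n-1}$, and $k\equiv2^{p-1}\ (\mathrm{mod}\ 2^p)$ with $1\le p\le n-1$, then moving to $y$ corresponds to applying $A^{1+2(p-1)}$ if $n\equiv k\ (\mathrm{mod}\ 2)$, and $D^{1+2(p-1)}$ otherwise. In other words: let $g_1=I$ and $g_{m+1}=g_mW_m$ for $m\ge1$, where $W_m$ is the product of powers of $A$ and $D$ assigned above to the move $r_m\to r_{m+1}$. Then for every $m\ge1$ the base point $g_m(i)$ is the point $X_{r_m}(i)\in\mathbb H$ corresponding to $r_m$, and each factor $A^t$ or $D^t$ ($t>0$), applied successively by right multiplication from left to right, moves the base point clockwise along a Ford circle.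
   Context: A pair of nonnegative reduced fractions $\frac ab<\frac cd$ (with $\frac10$ allowed) is a Farey pair if $bc-ad=1$; its mediant is $\frac ab\oplus\frac cd=\frac{a+c}{b+d}$. The Stern-Brocot tree is the binary tree with root $\frac11=\frac01\oplus\frac10$: if $x$ is the mediant of the Farey pair $\alpha<\beta$ (its left and right parents), its left child is $\alpha\oplus x$ and its right child is $x\oplus\beta$. It contains every positive rational exactly once. $\mathrm{depth}(x)$ is the level of $x$, the root having depth $1$. $r_m$ ($m\ge1$) is the $m$-th rational obtained by reading the tree row by row from left to right, starting from the root. For $x$ with left parent $\frac ms$ and right parent $\frac nt$, let $X_x=\begin{pmatrix}n&m\\t&s\end{pmatrix}\in SL(2,\mathbb Z)$ (so $X_x(1)=x$ and $X_1=I$). The point of the upper half-plane $\mathbb H$ corresponding to $x$ is $X_x(i)$, which is the tangency point of the Ford circles of the two parents of $x$. For a reduced fraction $\frac pq$ with $q\neq0$, the Ford circle $C_{p/q}$ is the circle in $\mathbb H$ tangent to $\mathbb R$ at $\frac pq$ with diameter $1/q^2$; $C_{1/0}$ is the line $\{\mathrm{Im}\,z=1\}$, on which "clockwise" means the negative direction (decreasing real part). The unit tangent bundle $S\mathbb H$ is identified with $PSL(2,\mathbb R)$: $g$ corresponds to the image under $g$ of the upward unit vector at $i$, with base point $g(i)$. The negative and positive horocyclic flows are the right multiplications $h^-_t:g\mapsto g\begin{pmatrix}1&0\\t&1\end{pmatrix}$ and $h^+_t:g\mapsto g\begin{pmatrix}1&t\\0&1\end{pmatrix}$. For a positive integer $t$,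 $A^t=\begin{pmatrix}1&0\\t&1\end{pmatrix}$ (flow $h^-$ for time $t$) and $D^t=\begin{pmatrix}1&-t\\0&1\end{pmatrix}$ (flow $h^+$ for time $-t$); $A^0=D^0=I$. "Applying" a product such as $A^{n-1}D^n$ to $g$ means $g\mapsto gA^{n-1}D^n$, i.e. first flowing by $A^{n-1}$ and then by $D^n$. *)

theory Defs
  imports "HOL-Analysis.Analysis" "HOL-Number_Theory.Cong"
begin

section \<open>The Stern-Brocot tree\<close>

text \<open>The fraction \<open>a/b\<close> is the pair \<open>(a, b)\<close>, so that \<open>1/0\<close> is available.\<close>

type_synonym frac = "nat \<times> nat"

definition farey_pair :: "frac \<Rightarrow> frac \<Rightarrow> bool" where
  "farey_pair \<alpha> \<beta> \<longleftrightarrow>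
     coprime (fst \<alpha>) (snd \<alpha>) \<and> coprime (fst \<beta>) (snd \<beta>) \<and>
     int (snd \<alpha>) * int (fst \<beta>) - int (fst \<alpha>) * int (snd \<beta>) = 1"

definition mediant :: "frac \<Rightarrow> frac \<Rightarrow> frac" where
  "mediant \<alpha> \<beta> = (fst \<alpha> + fst \<beta>, snd \<alpha> + snd \<beta>)"

text \<open>A node is stored as the Farey pair of its left and right parents;
  the rational sitting at the node is the mediant of this pair.\<close>

type_synonym sb_node = "frac \<times> frac"

definition node_rat :: "sb_node \<Rightarrow> rat" where
  "node_rat v = (let x = mediant (fst v) (snd v) in of_nat (fst x) / of_nat (snd x))"

definition children :: "sb_node \<Rightarrow> sb_node list" where
  "children v = (let x = mediant (fst v) (snd v) in [(fst v, x), (x, snd v)])"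

text \<open>Levels are listed from left to right and counted from 1; there is no level 0.\<close>

fun sb_row :: "nat \<Rightarrow> sb_node list" where
  "sb_row 0 = []"
| "sb_row (Suc 0) = [((0, 1), (1, 0))]"
| "sb_row (Suc (Suc n)) = concat (map children (sb_row (Suc n)))"

lemma sb_row_farey_pair: "v \<in> set (sb_row n) \<Longrightarrow> farey_pair (fst v) (snd v)"
proof (induction n arbitrary: v rule: sb_row.induct)
  case (3 n)
  have det: "coprime a b" if "int c * int a - int d * int b = 1" for a b c d :: nat
  proof (rule coprimeI)
    fix e assume "e dvd a" "e dvd b"
    then have "int e dvd int c * int a - int d * int b" by simp
    then show "is_unit e" using that by simp
  qed
  from "3.prems" obtain u where u: "u \<in> set (sb_row (Suc n))" "v \<in> set (children u)"
    by auto
  obtain a b c d where uv: "u = ((a, b), (c, d))" by (metis surj_pair)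
  have F: "coprime a b" "coprime c d" "int b * int c - int a * int d = 1"
    using "3.IH"[OF u(1)] by (auto simp: uv farey_pair_def)
  have "coprime (a + c) (b + d)"
    by (rule det[of b _ a]) (use F(3) in \<open>simp add: algebra_simps\<close>)
  then show ?case
    using u(2) F by (auto simp: uv farey_pair_def children_def mediant_def Let_def algebra_simps)
qed (auto simp: farey_pair_def)

text \<open>\<open>sb_elem m\<close> is the \<open>m\<close>-th rational (\<open>m \<ge> 1\<close>) in the row by row reading of the tree.
  No level from 1 on is empty, so the first \<open>m\<close> levels suffice.\<close>

definition sb_elem :: "nat \<Rightarrow> rat" where
  "sb_elem m = map node_rat (concat (map sb_row [1..<Suc m])) ! (m - 1)"

text \<open>Every positive rational occurs exactly once in the tree, so the descriptions in the
  next two definitions are proper for positive \<open>x\<close>.\<close>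

definition depth :: "rat \<Rightarrow> nat" where
  "depth x = (THE n. x \<in> node_rat ` set (sb_row n))"

definition sb_parents :: "rat \<Rightarrow> frac \<times> frac" where
  "sb_parents x = (THE v. v \<in> (\<Union>n. set (sb_row n)) \<and> node_rat v = x)"


section \<open>Horocyclic flows and Ford circles\<close>

text \<open>Elements of \<open>PSL(2,\<real>)\<close>, i.e. unit tangent vectors of the upper half-plane, are represented
  by matrices in \<open>SL(2,\<real>)\<close>. The base point does not depend on the choice of sign, and
  right multiplication is compatible with it.\<close>

definition mat22 :: "real \<Rightarrow> real \<Rightarrow> real \<Rightarrow> real \<Rightarrow> real^2^2" where
  "mat22 a b c d = vector [vector [a, b], vector [c, d]]"

definition moebius :: "real^2^2 \<Rightarrow> complex \<Rightarrow> complex" where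
  "moebius g z = (of_real (g$1$1) * z + of_real (g$1$2)) / (of_real (g$2$1) * z + of_real (g$2$2))"

definition base_point :: "real^2^2 \<Rightarrow> complex" where
  "base_point g = moebius g \<i>"

definition sb_matrix :: "rat \<Rightarrow> real^2^2" where
  "sb_matrix x = (case sb_parents x of ((m, s), (n, t)) \<Rightarrow>
     mat22 (of_nat n) (of_nat m) (of_nat t) (of_nat s))"

definition h_minus :: "real \<Rightarrow> real^2^2 \<Rightarrow> real^2^2" where
  "h_minus t g = g ** mat22 1 0 t 1"

definition h_plus :: "real \<Rightarrow> real^2^2 \<Rightarrow> real^2^2" where
  "h_plus t g = g ** mat22 1 t 0 1"

text \<open>\<open>A_pow t\<close> and \<open>D_pow t\<close> are the formal factors \<open>A\<^sup>t\<close> and \<open>D\<^sup>t\<close>. A list of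
  factors stands for their product, the factors being applied in the order of the list.\<close>

datatype factor = A_pow nat | D_pow nat

fun factor_time :: "factor \<Rightarrow> nat" where
  "factor_time (A_pow t) = t"
| "factor_time (D_pow t) = t"

fun factor_flow :: "factor \<Rightarrow> real \<Rightarrow> real^2^2 \<Rightarrow> real^2^2" where
  "factor_flow (A_pow t) s = h_minus s"
| "factor_flow (D_pow t) s = h_plus (- s)"

fun factor_matrix :: "factor \<Rightarrow> real^2^2" where
  "factor_matrix (A_pow t) = mat22 1 0 (real t) 1"
| "factor_matrix (D_pow t) = mat22 1 (- real t) 0 1"

lemma factor_flow_time: "factor_flow f (real (factor_time f)) g = g ** factor_matrix f"
  by (cases f) (auto simp: h_minus_def h_plus_def)

fun word_matrix :: "factor list \<Rightarrow> real^2^2" where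
  "word_matrix [] = mat 1"
| "word_matrix (f # w) = factor_matrix f ** word_matrix w"

definition ford_center :: "int \<Rightarrow> nat \<Rightarrow> complex" where
  "ford_center p q = Complex (of_int p / of_nat q) (1 / (2 * of_nat q ^ 2))"

definition ford_radius :: "nat \<Rightarrow> real" where
  "ford_radius q = 1 / (2 * of_nat q ^ 2)"

text \<open>As a subset of the upper half-plane, the circle does not contain its point of tangency
  with the real axis.\<close>

definition ford_circle :: "int \<Rightarrow> nat \<Rightarrow> complex set" where
  "ford_circle p q =
     (if q = 0 then {z. Im z = 1}
      else {z. Im z > 0 \<and> dist (ford_center p q) z = ford_radius q})"

text \<open>The path \<open>\<gamma>\<close> on the time interval \<open>[0, T]\<close> moves clockwise along the Ford circle of \<open>p/q\<close>:
  on a proper circle, the angle seen from the Euclidean center decreases continuously and strictly.\<close>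

definition moves_clockwise_on_ford :: "int \<Rightarrow> nat \<Rightarrow> (real \<Rightarrow> complex) \<Rightarrow> real \<Rightarrow> bool" where
  "moves_clockwise_on_ford p q \<gamma> T \<longleftrightarrow>
     continuous_on {0..T} \<gamma> \<and> \<gamma> ` {0..T} \<subseteq> ford_circle p q \<and>
     (if q = 0 then strict_antimono_on {0..T} (\<lambda>s. Re (\<gamma> s))
      else \<exists>\<theta>. continuous_on {0..T} \<theta> \<and> strict_antimono_on {0..T} \<theta> \<and>
             (\<forall>s\<in>{0..T}. \<gamma> s = ford_center p q + of_real (ford_radius q) * cis (\<theta> s)))"

definition clockwise_along_ford_circle :: "(real \<Rightarrow> complex) \<Rightarrow> real \<Rightarrow> bool" where
  "clockwise_along_ford_circle \<gamma> T \<longleftrightarrow>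
     (\<exists>p q. coprime p (int q) \<and> (q = 0 \<longrightarrow> p = 1) \<and> moves_clockwise_on_ford p q \<gamma> T)"


section \<open>The word assigned to a horizontal move\<close>

text \<open>\<open>sb_move m w\<close>: the word \<open>w\<close> is assigned to the move from the \<open>m\<close>-th to the next element.\<close>

inductive sb_move :: "nat \<Rightarrow> factor list \<Rightarrow> bool" where
  rightmost_even:
    "m \<ge> 1 \<Longrightarrow> depth (sb_elem m) = n \<Longrightarrow> m = 2 ^ n - 1 \<Longrightarrow> even n \<Longrightarrow>
     sb_move m [A_pow (n - 1), D_pow n]"
| rightmost_odd:
    "m \<ge> 1 \<Longrightarrow> depth (sb_elem m) = n \<Longrightarrow> m = 2 ^ n - 1 \<Longrightarrow> odd n \<Longrightarrow>
     sb_move m [D_pow (n - 1), A_pow n]"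
| inner_cong:
    "m \<ge> 1 \<Longrightarrow> depth (sb_elem m) = n \<Longrightarrow> m = 2 ^ (n - 1) + (k - 1) \<Longrightarrow>
     1 \<le> k \<Longrightarrow> k < 2 ^ (n - 1) \<Longrightarrow> 1 \<le> p \<Longrightarrow> p \<le> n - 1 \<Longrightarrow> [k = 2 ^ (p - 1)] (mod 2 ^ p) \<Longrightarrow>
     [n = k] (mod 2) \<Longrightarrow>
     sb_move m [A_pow (1 + 2 * (p - 1))]"
| inner_not_cong:
    "m \<ge> 1 \<Longrightarrow> depth (sb_elem m) = n \<Longrightarrow> m = 2 ^ (n - 1) + (k - 1) \<Longrightarrow>
     1 \<le> k \<Longrightarrow> k < 2 ^ (n - 1) \<Longrightarrow> 1 \<le> p \<Longrightarrow> p \<le> n - 1 \<Longrightarrow> [k = 2 ^ (p - 1)] (mod 2 ^ p) \<Longrightarrow>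
     \<not> [n = k] (mod 2) \<Longrightarrow>
     sb_move m [D_pow (1 + 2 * (p - 1))]"

definition sb_word :: "nat \<Rightarrow> factor list" where
  "sb_word m = (THE w. sb_move m w)"

end

theory Submission
  imports Defs
begin

text \<open>Passing to the left or right child multiplies the matrix \<open>X\<close> of a node by \<open>A\<close> or
  \<open>D\<^sup>-\<^sup>1\<close>, so the successor of an inner node \<open>X = P A D\<^sup>-\<^sup>v\<close> is \<open>P D\<^sup>-\<^sup>1 A\<^sup>v\<close>. With the quarter turn
  \<open>R = A D A = D A D\<close>, which fixes \<open>\<i>\<close> and interchanges \<open>A\<close> and \<open>D\<close> by conjugation, the successor
  is \<open>X D\<^sup>1\<^sup>+\<^sup>2\<^sup>v R\<^sup>-\<^sup>1\<close>. Hence \<open>g\<^sub>m\<close> is, up to sign, alternately \<open>X\<close> and \<open>X R\<close> along a level, and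
  the next move is a power of \<open>D\<close> in the first case and of \<open>A\<close> in the second one. The clockwise
  motion needs no knowledge of \<open>g\<^sub>m\<close> beyond its being an integral matrix of determinant 1.\<close>


section \<open>Two by two matrices\<close>

lemma mat22_nth [simp]:
  "mat22 a b c d $ 1 $ 1 = a" "mat22 a b c d $ 1 $ 2 = b"
  "mat22 a b c d $ 2 $ 1 = c" "mat22 a b c d $ 2 $ 2 = d"
  by (simp_all add: mat22_def)

lemma mat22_eq_iff [simp]:
  "mat22 a b c d = mat22 a' b' c' d' \<longleftrightarrow> a = a' \<and> b = b' \<and> c = c' \<and> d = d'"
  by (auto simp: vec_eq_iff forall_2)

lemma mat22_mult [simp]:
  "mat22 a b c d ** mat22 a' b' c' d' =
     mat22 (a * a' + b * c') (a * b' + b * d') (c * a' + d * c') (c * b' + d * d')"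
  by (simp add: vec_eq_iff forall_2 matrix_matrix_mult_def sum_2)

lemma mat_1_eq_mat22: "mat 1 = mat22 1 0 0 1"
  by (simp add: vec_eq_iff forall_2 mat_def)

lemma mat22_cases:
  obtains a b c d where "M = mat22 a b c d"
proof
  show "M = mat22 (M$1$1) (M$1$2) (M$2$1) (M$2$2)"
    by (simp add: vec_eq_iff forall_2)
qed

lemma base_point_mat22:
  "base_point (mat22 a b c d) =
     (of_real a * \<i> + of_real b) / (of_real c * \<i> + of_real d)"
  by (simp add: base_point_def moebius_def)

text \<open>Integrality makes the \<open>h_minus\<close> orbit a Ford circle rather than a horocycle
  of arbitrary size: for \<open>d \<noteq> 0\<close> the tangency point \<open>b / d\<close> is in
  lowest terms and the diameter is \<open>1 / d^2\<close>.\<close>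

definition integral_sl2 :: "real^2^2 \<Rightarrow> bool" where
  "integral_sl2 M \<longleftrightarrow>
     (\<exists>a b c d :: int. a * d - b * c = 1 \<and> M = mat22 (of_int a) (of_int b) (of_int c) (of_int d))"

lemma integral_sl2I:
  fixes a b c d :: int
  assumes "a * d - b * c = 1"
  shows "integral_sl2 (mat22 (of_int a) (of_int b) (of_int c) (of_int d))"
  using assms by (auto simp: integral_sl2_def)

lemma integral_sl2_mult:
  assumes "integral_sl2 M" "integral_sl2 N"
  shows "integral_sl2 (M ** N)"
proof -
  obtain a b c d :: int where M: "a * d - b * c = 1"
    "M = mat22 (of_int a) (of_int b) (of_int c) (of_int d)"
    using assms(1) by (auto simp: integral_sl2_def)
  obtain a' b' c' d' :: int where N: "a' * d' - b' * c' = 1"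
    "N = mat22 (of_int a') (of_int b') (of_int c') (of_int d')"
    using assms(2) by (auto simp: integral_sl2_def)
  have "(a * a' + b * c') * (c * b' + d * d') - (a * b' + b * d') * (c * a' + d * c') =
    (a * d - b * c) * (a' * d' - b' * c')"
    by (simp add: algebra_simps)
  then show ?thesis
    using integral_sl2I[of "a * a' + b * c'" "c * b' + d * d'" "a * b' + b * d'" "c * a' + d * c'"] M N
    by simp
qed

lemma integral_sl2_one: "integral_sl2 (mat 1)"
  using integral_sl2I[of 1 1 0 0] by (simp add: mat_1_eq_mat22)

lemma integral_sl2_word_matrix: "integral_sl2 (word_matrix w)"
proof (induction w)
  case (Cons f w)
  have "integral_sl2 (factor_matrix f)"
    using integral_sl2I[of 1 1 0 "int (factor_time f)"] integral_sl2I[of 1 1 "- int (factor_time f)" 0]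
    by (cases f) auto
  with Cons show ?case by (simp add: integral_sl2_mult)
qed (simp add: integral_sl2_one)

lemma Im_base_point_pos:
  assumes "integral_sl2 M"
  shows "Im (base_point M) > 0"
proof -
  obtain a b c d :: int where M: "a * d - b * c = 1"
    "M = mat22 (of_int a) (of_int b) (of_int c) (of_int d)"
    using assms by (auto simp: integral_sl2_def)
  have "c \<noteq> 0 \<or> d \<noteq> 0" using M(1) by auto
  then have "(real_of_int c)\<^sup>2 + (real_of_int d)\<^sup>2 > 0"
    by (simp add: sum_power2_gt_zero_iff)
  moreover have "real_of_int a * of_int d - of_int b * of_int c = 1"
    using M(1) by (metis of_int_1 of_int_diff of_int_mult)
  ultimately show ?thesis
    by (simp add: M(2) base_point_mat22 Im_divide add.commute)
qed


section \<open>Horocyclic flow along Ford circles\<close>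

text \<open>The orbit of \<open>h\<^sup>-\<close> through \<open>M\<close> is the Ford circle at \<open>M(0) = b/d\<close>; centered there and
  scaled, its point at time \<open>s\<close> is the Cayley transform of \<open>c/d + s\<close>.\<close>

lemma cis_two_arctan: "cis (pi / 2 - 2 * arctan w) = \<i> * (1 - \<i> * of_real w) / (1 + \<i> * of_real w)"
proof -
  have nz: "1 + \<i> * complex_of_real w \<noteq> 0"
    by (auto simp: complex_eq_iff)
  have pos: "1 + w\<^sup>2 \<noteq> 0" by (metis add_pos_nonneg less_irrefl zero_le_power2 zero_less_one)
  \<comment> \<open>The number \<open>1 + \<i> * w\<close> has argument \<open>arctan w\<close>;
    squaring doubles it.\<close>
  have "cis (arctan w) = (1 + \<i> * of_real w) / of_real (sqrt (1 + w\<^sup>2))"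
    by (simp add: complex_eq_iff cos_arctan sin_arctan Re_divide_of_real Im_divide_of_real)
  then have "cis (2 * arctan w) = ((1 + \<i> * of_real w) / of_real (sqrt (1 + w\<^sup>2)))\<^sup>2"
    using Complex.DeMoivre[of "arctan w" 2] by simp
  also have "\<dots> = (1 + \<i> * of_real w)\<^sup>2 / of_real (1 + w\<^sup>2)"
    using pos by (simp add: power_divide flip: of_real_power)
  also have "of_real (1 + w\<^sup>2) = (1 + \<i> * of_real w) * (1 - \<i> * complex_of_real w)"
    by (simp add: algebra_simps power2_eq_square)
  also have "(1 + \<i> * of_real w)\<^sup>2 / \<dots> = (1 + \<i> * of_real w) / (1 - \<i> * complex_of_real w)"
    using nz by (simp add: power2_eq_square)
  finally have "cis (2 * arctan w) = (1 + \<i> * of_real w) / (1 - \<i> * complex_of_real w)" .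
  then show ?thesis
    by (simp flip: cis_divide)
qed

lemma h_minus_clockwise:
  assumes "integral_sl2 M"
  shows "clockwise_along_ford_circle (\<lambda>s. base_point (h_minus s M)) T"
proof -
  obtain a b c d :: int where det: "a * d - b * c = 1"
    and M: "M = mat22 (of_int a) (of_int b) (of_int c) (of_int d)"
    using assms by (auto simp: integral_sl2_def)
  define \<gamma> where "\<gamma> s = base_point (h_minus s M)" for s
  have \<gamma>: "\<gamma> s = (of_real (of_int a + of_int b * s) * \<i> + of_int b) /
      (of_real (of_int c + of_int d * s) * \<i> + of_int d)" for s
    by (simp add: \<gamma>_def h_minus_def M base_point_mat22)
  have "clockwise_along_ford_circle \<gamma> T"
  proof (cases "d = 0")
    \<comment> \<open>The tangency point is infinite, and the flow moves left along the line of
      height 1.\<close>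
    case True
    then have "c = 1 \<and> b = -1 \<or> c = -1 \<and> b = 1"
      using det zmult_eq_1_iff[of c "- b"] by (auto simp: mult.commute)
    then have eq: "\<gamma> s = Complex (of_int (a * c) - s) 1" for s
      using True by (auto simp: \<gamma> complex_eq_iff)
    have "moves_clockwise_on_ford 1 0 \<gamma> T"
      by (auto simp: moves_clockwise_on_ford_def eq ford_circle_def monotone_on_def Complex_eq
          intro!: continuous_intros)
    then show ?thesis unfolding clockwise_along_ford_circle_def by force
  next
    case False
    \<comment> \<open>Ford circles are indexed by natural denominators, so the sign of
      \<open>d\<close> is moved into the numerator.\<close>
    define p q where "p = sgn d * b" and "q = nat \<bar>d\<bar>"
    have q: "real q = \<bar>of_int d\<bar>" "int q = sgn d * d" "q \<noteq> 0"
      using False by (auto simp: q_def sgn_if)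
    have q2: "(real q)\<^sup>2 = (of_int d)\<^sup>2" by (simp add: q)
    have pq: "of_int p / real q = of_int b / of_int d"
      using False by (auto simp: q p_def sgn_if)
    have cop: "coprime p (int q)"
    proof (rule coprimeI)
      fix e assume "e dvd p" "e dvd int q"
      then have "e dvd b" "e dvd d"
        using False by (auto simp: p_def q(2) sgn_if split: if_splits)
      then have "e dvd a * d - b * c" by simp
      then show "is_unit e" using det by simp
    qed
    define \<theta> where "\<theta> s = pi / 2 - 2 * arctan (of_int c / of_int d + s)" for s :: real
    have circle: "\<gamma> s = ford_center p q + of_real (ford_radius q) * cis (\<theta> s)" for s
    proof -
      define w where "w = real_of_int c / of_int d + s"
      define W where "W = complex_of_real w"
      define B where "B = complex_of_int b"
      define E where "E = complex_of_int d"
      have E: "E \<noteq> 0" using False by (simp add: E_def)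
      have nz: "1 + \<i> * W \<noteq> 0" by (auto simp: W_def complex_eq_iff)
      have c1: "complex_of_real (of_int c + of_int d * s) = E * W"
        using False by (simp add: W_def w_def E_def field_simps)
      \<comment> \<open>The determinant eliminates \<open>a\<close>, after which time enters through
        \<open>w = c / d + s\<close> alone.\<close>
      have a1: "complex_of_real (of_int a + of_int b * s) = (1 + B * E * W) / E"
      proof -
        have "real_of_int a * of_int d - of_int b * of_int c = 1"
          using det by (metis of_int_1 of_int_diff of_int_mult)
        then have "real_of_int a + of_int b * s = (1 + of_int b * of_int d * w) / of_int d"
          using False by (simp add: w_def field_simps)
        then show ?thesis by (simp add: W_def B_def E_def)
      qed
      have "\<gamma> s = ((1 + B * E * W) / E * \<i> + B) / (E * W * \<i> + E)"
        unfolding \<gamma> c1 a1 B_def E_def by simp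
      also have "\<dots> = B / E + \<i> / (2 * E\<^sup>2) + 1 / (2 * E\<^sup>2) * (\<i> * (1 - \<i> * W) / (1 + \<i> * W))"
      proof -
        have d: "E * W * \<i> + E = E * (1 + \<i> * W)" by (simp add: algebra_simps)
        show ?thesis unfolding d using E nz
          by (simp add: divide_simps) (simp add: algebra_simps power2_eq_square)
      qed
      also have "\<i> * (1 - \<i> * W) / (1 + \<i> * W) = cis (\<theta> s)"
        by (simp add: \<theta>_def cis_two_arctan W_def w_def)
      also have "1 / (2 * E\<^sup>2) = of_real (ford_radius q)"
        by (simp add: ford_radius_def q2 E_def)
      also have "B / E + \<i> / (2 * E\<^sup>2) = ford_center p q"
      proof -
        have "B / E = of_real (of_int b / of_int d)" "\<i> / (2 * E\<^sup>2) = \<i> * of_real (1 / (2 * (of_int d)\<^sup>2))"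
          by (simp_all add: B_def E_def)
        then show ?thesis unfolding ford_center_def pq q2 by (simp add: Complex_eq)
      qed
      finally show ?thesis .
    qed
    have \<theta>: "continuous_on {0..T} \<theta>" "strict_antimono_on {0..T} \<theta>"
      by (auto simp: \<theta>_def monotone_on_def arctan_less_iff intro!: continuous_intros)
    have "continuous_on {0..T} \<gamma>"
      unfolding circle cis_conv_exp using \<theta>(1) by (intro continuous_intros)
    moreover have "\<gamma> s \<in> ford_circle p q" for s
    proof -
      \<comment> \<open>The distance equation does not exclude the tangency point on the real axis,
        so the positive imaginary part is shown separately.\<close>
      have "real_of_int a * of_int d - of_int b * of_int c = 1"
        using det by (metis of_int_1 of_int_diff of_int_mult)
      moreover have "(real_of_int c + of_int d * s)\<^sup>2 + (of_int d)\<^sup>2 > 0"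
        using False by (simp add: add_nonneg_pos)
      ultimately have "Im (\<gamma> s) > 0"
        unfolding \<gamma> by (simp add: Im_divide algebra_simps)
      moreover have "dist (ford_center p q) (\<gamma> s) = ford_radius q"
        by (simp add: circle dist_norm norm_mult norm_divide norm_power ford_radius_def)
      ultimately show ?thesis using q by (simp add: ford_circle_def)
    qed
    ultimately have "moves_clockwise_on_ford p q \<gamma> T"
      using \<theta> circle q by (auto simp: moves_clockwise_on_ford_def)
    then show ?thesis using cop q unfolding clockwise_along_ford_circle_def by blast
  qed
  then show ?thesis by (simp add: \<gamma>_def[abs_def])
qed

section \<open>The quarter turn\<close>

text \<open>\<open>turn False s\<close> is \<open>\<plusminus>I\<close> and \<open>turn True s\<close> is \<open>\<plusminus>R\<close>, for the sign \<open>s\<close>.\<close>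

definition turn :: "bool \<Rightarrow> real \<Rightarrow> real^2^2" where
  "turn b s = (if b then mat22 0 (- s) s 0 else mat22 s 0 0 s)"

text \<open>A turn multiplies numerator and denominator by the same number, \<open>s\<close> or
  \<open>s * \<i>\<close>.\<close>

lemma base_point_turn:
  assumes "s \<noteq> 0"
  shows "base_point (M ** turn b s) = base_point M"
proof (cases M rule: mat22_cases)
  case (1 p q u v)
  have "base_point (M ** turn True s) =
      (of_real s * \<i> * (of_real p * \<i> + of_real q)) / (of_real s * \<i> * (of_real u * \<i> + of_real v))"
    unfolding 1 turn_def by (simp add: base_point_mat22 algebra_simps)
  moreover have "base_point (M ** turn False s) =
      (of_real s * (of_real p * \<i> + of_real q)) / (of_real s * (of_real u * \<i> + of_real v))"
    unfolding 1 turn_def by (simp add: base_point_mat22 algebra_simps)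
  ultimately show ?thesis using assms
    by (cases b) (simp_all add: 1 base_point_mat22 del: times_divide_eq_right)
qed

text \<open>Since \<open>D\<^sup>s R = R A\<^sup>s\<close> and \<open>R\<close> does not move base
  points, the \<open>D\<close> orbit of \<open>M\<close> has the same base points as the
  \<open>A\<close> orbit of \<open>M R\<close>.\<close>

lemma factor_flow_clockwise:
  assumes "integral_sl2 M"
  shows "clockwise_along_ford_circle (\<lambda>s. base_point (factor_flow f s M)) T"
proof (cases f)
  case (A_pow t)
  then show ?thesis using h_minus_clockwise[OF assms] by simp
next
  case (D_pow t)
  have "base_point (h_plus (- s) M) = base_point (h_minus s (M ** turn True 1))" for s
  proof -
    have "h_plus (- s) M ** turn True 1 = h_minus s (M ** turn True 1)"
      by (cases M rule: mat22_cases) (simp add: h_plus_def h_minus_def turn_def algebra_simps)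
    then show ?thesis using base_point_turn[of 1 "h_plus (- s) M" True] by simp
  qed
  moreover have "integral_sl2 (M ** turn True 1)"
    using integral_sl2I[of 0 0 "-1" 1] assms by (auto simp: turn_def intro: integral_sl2_mult)
  ultimately show ?thesis using D_pow h_minus_clockwise by simp
qed


section \<open>Rows of the tree\<close>

lemma length_sb_row: "length (sb_row (Suc n)) = 2 ^ n"
proof (induction n)
  case (Suc n)
  have "length (concat (map children xs)) = 2 * length xs" for xs
    by (induction xs) (auto simp: children_def Let_def)
  with Suc show ?case by simp
qed simp

lemma nth_children:
  assumes "i < length xs"
  shows "concat (map children xs) ! (2 * i) = (fst (xs ! i), mediant (fst (xs ! i)) (snd (xs ! i)))"
    and "concat (map children xs) ! Suc (2 * i) = (mediant (fst (xs ! i)) (snd (xs ! i)), snd (xs ! i))"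
  using assms
proof (induction xs arbitrary: i)
  case (Cons v xs)
  { case 1 then show ?case using Cons(1) by (cases i) (auto simp: children_def Let_def) }
  { case 2 then show ?case using Cons(2) by (cases i) (auto simp: children_def Let_def) }
qed auto

text \<open>This is \<open>sb_matrix\<close> read off the node itself;
  \<open>sb_matrix_sb_elem\<close> makes the link once each rational is known to determine its
  node.\<close>

definition node_matrix :: "sb_node \<Rightarrow> real^2^2" where
  "node_matrix v = mat22 (of_nat (fst (snd v))) (of_nat (fst (fst v)))
                         (of_nat (snd (snd v))) (of_nat (snd (fst v)))"

text \<open>Both indices are zero-based: this is the node in position \<open>j\<close> of the level \<open>n + 1\<close>.\<close>

abbreviation row_matrix :: "nat \<Rightarrow> nat \<Rightarrow> real^2^2" where
  "row_matrix n j \<equiv> node_matrix (sb_row (Suc n) ! j)"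

lemma row_matrix_0: "row_matrix 0 0 = mat 1"
  by (simp add: node_matrix_def mat_1_eq_mat22)

text \<open>A child keeps one parent and replaces the other by the mediant, which adds one column to
  the other.\<close>

lemma row_matrix_Suc:
  assumes "j < 2 ^ n"
  shows "row_matrix (Suc n) (2 * j) = row_matrix n j ** mat22 1 0 1 1"
    and "row_matrix (Suc n) (Suc (2 * j)) = row_matrix n j ** mat22 1 1 0 1"
  using assms nth_children[of j "sb_row (Suc n)"]
  by (simp_all add: length_sb_row node_matrix_def mediant_def algebra_simps)

lemma row_matrix_leftmost: "row_matrix n 0 = mat22 1 0 (real n) 1"
proof (induction n)
  case (Suc n)
  then show ?case using row_matrix_Suc(1)[of 0 n] by simp
qed (simp add: node_matrix_def)

lemma row_matrix_rightmost: "row_matrix n (2 ^ n - 1) = mat22 1 (real n) 0 1"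
proof (induction n)
  case (Suc n)
  have "2 ^ Suc n - 1 = Suc (2 * (2 ^ n - 1 :: nat))"
    by (cases "2 ^ n :: nat") auto
  then show ?case using row_matrix_Suc(2)[of "2 ^ n - 1" n] Suc by simp
qed (simp add: node_matrix_def)

text \<open>The factor is \<open>D\<^sup>t R\<^sup>-\<^sup>1\<close> for \<open>t = 2 v + 1\<close>, where \<open>v\<close> is the number of trailing right turns on
  the path to the node \<open>j\<close>.\<close>

lemma row_matrix_next:
  assumes "Suc j < 2 ^ n"
  shows "row_matrix n (Suc j) =
    row_matrix n j ** mat22 (1 + 2 * real (multiplicity 2 (Suc j))) 1 (- 1) 0"
  using assms
proof (induction n arbitrary: j)
  case (Suc n)
  show ?case
  proof (cases "even j")
    \<comment> \<open>The nodes \<open>j\<close> and \<open>Suc j\<close> are the two children of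
      one node.\<close>
    case True
    then obtain i where j: "j = 2 * i" by blast
    have "multiplicity 2 (Suc j) = 0" using True by (simp add: not_dvd_imp_multiplicity_0)
    then show ?thesis
      using Suc.prems row_matrix_Suc[of i n] unfolding j
      by (simp flip: matrix_mul_assoc del: sb_row.simps)
  next
    case False
    \<comment> \<open>Now \<open>j\<close> is the right child of \<open>i\<close>, and
      \<open>Suc j\<close> the left child of \<open>Suc i\<close>, to which the induction hypothesis
      leads.\<close>
    then obtain i where j: "j = Suc (2 * i)" by (metis oddE Suc_eq_plus1)
    have i: "Suc i < 2 ^ n" using Suc.prems j by simp
    have v: "multiplicity 2 (Suc j) = Suc (multiplicity 2 (Suc i))"
      using multiplicity_times_same[where p = 2 and x = "Suc i"] by (simp add: j)
    have "row_matrix (Suc n) (Suc j) = row_matrix n (Suc i) ** mat22 1 0 1 1"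
      using row_matrix_Suc(1)[OF i] by (simp add: j del: sb_row.simps)
    also have "\<dots> = row_matrix n i ** mat22 1 1 0 1 **
        mat22 (1 + 2 * real (multiplicity 2 (Suc j))) 1 (- 1) 0"
      unfolding Suc.IH[OF i] v by (simp flip: matrix_mul_assoc)
    finally show ?thesis
      using row_matrix_Suc(2)[of i n] i by (simp add: j del: sb_row.simps)
  qed
qed simp

lemma sb_elem_eq:
  assumes "j < 2 ^ n"
  shows "sb_elem (2 ^ n + j) = node_rat (sb_row (Suc n) ! j)"
proof -
  have len: "length (concat (map sb_row [1..<Suc n])) = 2 ^ n - 1" for n
    by (induction n) (auto simp: length_sb_row simp del: sb_row.simps(3))
  \<comment> \<open>Hence level \<open>n + 1\<close> is among the levels that \<open>sb_elem\<close>
    reads.\<close>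
  have le: "n < 2 ^ n + j" using less_exp[of n] by (simp add: trans_less_add1)
  have "[1..<Suc (2 ^ n + j)] = [1..<Suc n] @ [Suc n..<Suc (2 ^ n + j)]"
    using upt_add_eq_append[of 1 "Suc n" "2 ^ n + j - n"] le by simp
  moreover have "[Suc n..<Suc (2 ^ n + j)] = Suc n # [Suc (Suc n)..<Suc (2 ^ n + j)]"
    using le by (simp add: upt_conv_Cons)
  ultimately have "concat (map sb_row [1..<Suc (2 ^ n + j)]) =
      concat (map sb_row [1..<Suc n]) @ sb_row (Suc n) @ concat (map sb_row [Suc (Suc n)..<Suc (2 ^ n + j)])"
    by (simp del: upt_Suc sb_row.simps)
  then obtain zs where zs: "concat (map sb_row [1..<Suc (2 ^ n + j)]) =
      concat (map sb_row [1..<Suc n]) @ sb_row (Suc n) @ zs" by blast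
  have "concat (map sb_row [1..<Suc (2 ^ n + j)]) ! (2 ^ n - 1 + j) = sb_row (Suc n) ! j"
    unfolding zs len[symmetric] nth_append_length_plus using assms
    by (simp add: nth_append length_sb_row del: sb_row.simps)
  moreover have "length (concat (map sb_row [1..<Suc (2 ^ n + j)])) > 2 ^ n - 1 + j"
    unfolding zs length_append len length_sb_row using assms by simp
  moreover have "2 ^ n + j - 1 = 2 ^ n - 1 + j" using one_le_power[of "2::nat" n] by simp
  ultimately show ?thesis unfolding sb_elem_def by (simp del: upt_Suc sb_row.simps)
qed


section \<open>Every rational occurs at most once\<close>

text \<open>A common divisor of the mediant's entries divides the determinant of the left parent and
  the mediant, which is again 1.\<close>

lemma farey_pair_coprime_mediant:
  assumes "farey_pair \<alpha> \<beta>"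
  shows "coprime (fst (mediant \<alpha> \<beta>)) (snd (mediant \<alpha> \<beta>))"
proof (rule coprimeI)
  fix e assume "e dvd fst (mediant \<alpha> \<beta>)" "e dvd snd (mediant \<alpha> \<beta>)"
  then have "int e dvd int (fst \<alpha> + fst \<beta>)" "int e dvd int (snd \<alpha> + snd \<beta>)"
    by (simp_all only: mediant_def fst_conv snd_conv int_dvd_int_iff)
  then have "int e dvd int (snd \<alpha>) * int (fst \<alpha> + fst \<beta>) - int (fst \<alpha>) * int (snd \<alpha> + snd \<beta>)"
    by (meson dvd_diff dvd_mult)
  also have "\<dots> = 1" using assms by (simp add: farey_pair_def algebra_simps)
  finally show "is_unit e" by simp
qed

text \<open>The left parent \<open>(a, b)\<close> solves \<open>b * p - a * q = 1\<close>. Two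
  solutions differ by a multiple \<open>t\<close> of \<open>(p, q)\<close>; as both lie between
  \<open>(0, 0)\<close> and \<open>(p, q)\<close>, \<open>t \<noteq> 0\<close> would make one of
  them \<open>(0, 0)\<close>, which is no solution.\<close>

lemma farey_pair_mediant_inj:
  assumes F: "farey_pair \<alpha> \<beta>" and F': "farey_pair \<alpha>' \<beta>'"
    and eq: "mediant \<alpha> \<beta> = mediant \<alpha>' \<beta>'"
  shows "\<alpha> = \<alpha>' \<and> \<beta> = \<beta>'"
proof -
  define a b a' b' p q where defs: "a = int (fst \<alpha>)" "b = int (snd \<alpha>)" "a' = int (fst \<alpha>')"
    "b' = int (snd \<alpha>')" "p = int (fst (mediant \<alpha> \<beta>))" "q = int (snd (mediant \<alpha> \<beta>))"
  have p': "p = int (fst (mediant \<alpha>' \<beta>'))" "q = int (snd (mediant \<alpha>' \<beta>'))"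
    using eq by (simp_all add: defs)
  have det: "b * p - a * q = 1" "b' * p - a' * q = 1"
    subgoal using F by (simp add: farey_pair_def defs mediant_def algebra_simps)
    subgoal using F' unfolding p' by (simp add: farey_pair_def defs mediant_def algebra_simps)
    done
  have "0 \<le> a" "a \<le> p" "0 \<le> b" "b \<le> q"
    by (simp_all add: defs mediant_def)
  moreover have "0 \<le> a'" "a' \<le> p" "0 \<le> b'" "b' \<le> q"
    by (simp_all only: p') (simp_all add: defs mediant_def)
  ultimately have bounds: "0 \<le> a" "a \<le> p" "0 \<le> b" "b \<le> q" "0 \<le> a'" "a' \<le> p" "0 \<le> b'" "b' \<le> q" .
  have cop: "coprime p q"
    using farey_pair_coprime_mediant[OF F] by (simp add: defs)
  have cross: "(b' - b) * p = (a' - a) * q" using det by (simp add: algebra_simps)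
  have "p dvd a' - a"
    using cop cross by (metis coprime_dvd_mult_left_iff dvd_triv_right)
  then obtain t where t: "a' - a = p * t" by blast
  have "p \<noteq> 0" using det bounds by auto
  moreover have "(b' - b) * p = q * t * p" using cross t by (simp add: mult_ac)
  ultimately have t': "b' - b = q * t" by simp
  have "\<not> t \<ge> 1"
  proof
    assume "t \<ge> 1"
    then have "p * 1 \<le> p * t" "q * 1 \<le> q * t" 
      using bounds mult_left_mono[of 1 t p] mult_left_mono[of 1 t q] by simp_all
    then have "a = 0" "b = 0" using t t' bounds by auto
    then show False using det by simp
  qed
  moreover have "\<not> t \<le> -1"
  proof
    assume "t \<le> -1"
    then have "p * t \<le> p * (-1)" "q * t \<le> q * (-1)" 
      using bounds mult_left_mono[of t "-1" p] mult_left_mono[of t "-1" q] by simp_all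
    then have "a' = 0" "b' = 0" using t t' bounds by auto
    then show False using det by simp
  qed
  ultimately have "t = 0" by linarith
  then have "\<alpha> = \<alpha>'" using t t' by (simp add: defs prod_eq_iff)
  then show ?thesis using eq by (simp add: mediant_def prod_eq_iff)
qed

text \<open>Mediants are in lowest terms, so equal rationals come from equal mediants.\<close>

lemma node_rat_inj:
  assumes F: "farey_pair (fst u) (snd u)" and F': "farey_pair (fst v) (snd v)"
    and eq: "node_rat u = node_rat v"
  shows "u = v"
proof -
  obtain p q where u: "mediant (fst u) (snd u) = (p, q)" by (metis surj_pair)
  obtain p' q' where v: "mediant (fst v) (snd v) = (p', q')" by (metis surj_pair)
  have cop: "coprime p q" "coprime p' q'"
    using farey_pair_coprime_mediant[OF F] farey_pair_coprime_mediant[OF F'] u v by simp_all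
  have nz: "q \<noteq> 0" "q' \<noteq> 0"
    using F F' u v by (auto simp: farey_pair_def mediant_def)
  have "(of_nat p / of_nat q :: rat) = of_nat p' / of_nat q'"
    using eq u v by (simp add: node_rat_def Let_def)
  then have "(of_nat (p * q') :: rat) = of_nat (p' * q)"
    using nz by (simp add: field_simps)
  then have "p * q' = p' * q" by (simp only: of_nat_eq_iff)
  then have "p = p' \<and> q = q'"
    using coprime_crossproduct_nat[of p q p' q'] cop nz
    by (simp add: mult.commute)
  then show ?thesis
    using farey_pair_mediant_inj[OF F F'] u v by (simp add: prod_eq_iff)
qed

text \<open>A child determines the node above it and the root is nobody's child, so a common node
  can be traced upwards in both levels at once.\<close>

lemma sb_row_disjoint:
  assumes "v \<in> set (sb_row m)" "v \<in> set (sb_row n)"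
  shows "m = n"
  using assms
proof (induction m arbitrary: v n rule: sb_row.induct)
  case 2
  have False if u: "u \<in> set (sb_row k)" "((0, 1), (1, 0)) \<in> set (children u)" for k u
    using sb_row_farey_pair[OF u(1)] u(2)
    by (auto simp: farey_pair_def children_def mediant_def Let_def)
  then show ?case using 2 by (cases n rule: sb_row.cases) auto
next
  case (3 m)
  have child: "v \<in> set (children u) \<longleftrightarrow> v = (fst u, mediant (fst u) (snd u)) \<or>
      v = (mediant (fst u) (snd u), snd u)" for u v
    by (auto simp: children_def Let_def)
  obtain u where u: "u \<in> set (sb_row (Suc m))" "v \<in> set (children u)"
    using "3.prems" by auto
  have F: "farey_pair (fst u) (snd u)" using sb_row_farey_pair[OF u(1)] .
  consider "n = Suc 0" | k where "n = Suc (Suc k)"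
    using "3.prems" by (cases n rule: sb_row.cases) auto
  then show ?case
  proof cases
    case 1
    then show ?thesis using u(2) F "3.prems"
      by (auto simp: farey_pair_def children_def mediant_def Let_def)
  next
    case 2
    then obtain u' where u': "u' \<in> set (sb_row (Suc k))" "v \<in> set (children u')"
      using "3.prems" by auto
    have F': "farey_pair (fst u') (snd u')" using sb_row_farey_pair[OF u'(1)] .
    \<comment> \<open>If a left child of one node were a right child of the other, adding up the
      mediants would give a parent \<open>(0, 0)\<close>.\<close>
    have "u = u'"
      using u(2) u'(2) F F' unfolding child
      by (auto simp: mediant_def prod_eq_iff farey_pair_def)
    then show ?thesis using "3.IH"[OF u(1)] u'(1) 2 by simp
  qed
qed simp

lemma depth_node_rat:
  assumes "v \<in> set (sb_row n)"
  shows "depth (node_rat v) = n"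
  unfolding depth_def
proof (rule the_equality)
  fix k assume "node_rat v \<in> node_rat ` set (sb_row k)"
  then obtain u where u: "u \<in> set (sb_row k)" "node_rat v = node_rat u" by blast
  then have "v = u" using assms by (intro node_rat_inj) (auto dest: sb_row_farey_pair)
  then show "k = n" using u assms sb_row_disjoint by blast
qed (use assms in blast)

lemma sb_parents_node_rat:
  assumes "v \<in> set (sb_row n)"
  shows "sb_parents (node_rat v) = v"
  unfolding sb_parents_def
  by (rule the_equality) (use assms in \<open>auto intro!: node_rat_inj dest: sb_row_farey_pair\<close>)

lemma sb_matrix_sb_elem:
  assumes "j < 2 ^ n"
  shows "sb_matrix (sb_elem (2 ^ n + j)) = row_matrix n j"
proof -
  have "sb_row (Suc n) ! j \<in> set (sb_row (Suc n))" using assms length_sb_row by (intro nth_mem) simp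
  then show ?thesis
    by (simp add: sb_elem_eq[OF assms] sb_matrix_def sb_parents_node_rat node_matrix_def split: prod.split
        del: sb_row.simps)
qed

lemma depth_sb_elem:
  assumes "j < 2 ^ n"
  shows "depth (sb_elem (2 ^ n + j)) = Suc n"
  unfolding sb_elem_eq[OF assms] using assms length_sb_row by (intro depth_node_rat nth_mem) simp


section \<open>The words\<close>

text \<open>Both sides say that \<open>k\<close> is an odd multiple of \<open>2 ^ v\<close>. With
  \<open>v = p - 1\<close> this shows that the congruence in \<open>sb_move\<close> determines
  \<open>p\<close>.\<close>

lemma multiplicity_2_eq_iff_cong:
  fixes k :: nat
  assumes "k > 0"
  shows "[k = 2 ^ v] (mod 2 ^ Suc v) \<longleftrightarrow> multiplicity 2 k = v"
proof
  assume cong: "[k = 2 ^ v] (mod 2 ^ Suc v)"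
  then have "[k = 2 ^ v] (mod 2 ^ v)" by (rule cong_dvd_modulus_nat) simp
  from cong_dvd_iff[OF this] have "2 ^ v dvd k" by simp
  moreover have "\<not> 2 ^ Suc v dvd k"
    using cong_dvd_iff[OF cong] by (simp add: dvd_power_iff_le)
  ultimately show "multiplicity 2 k = v" by (rule multiplicity_eqI)
next
  assume "multiplicity 2 k = v"
  then obtain y where y: "k = 2 ^ v * y" "\<not> 2 dvd y"
    using multiplicity_decompose'[of k 2] assms by auto
  then obtain z where "y = 2 * z + 1" by (metis oddE)
  then have "k = 2 ^ v + 2 ^ Suc v * z" using y by (simp add: algebra_simps)
  then show "[k = 2 ^ v] (mod 2 ^ Suc v)" by (simp add: cong_def del: power_Suc)
qed

lemma Suc_cong_mod_2_iff: "[Suc n = Suc j] (mod 2) \<longleftrightarrow> even (n + j)"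
  by (auto simp: cong_def mod_2_eq_odd)

text \<open>The depth is \<open>n + 1\<close> and the position \<open>k\<close> is
  \<open>j + 1\<close>: the parity test on the depth is reversed for rightmost nodes, while
  comparing the parities of depth and \<open>k\<close> amounts to comparing those of
  \<open>n\<close> and \<open>j\<close>.\<close>

definition move_word :: "nat \<Rightarrow> nat \<Rightarrow> factor list" where
  "move_word n j =
     (if Suc j = 2 ^ n
      then if odd n then [A_pow n, D_pow (Suc n)] else [D_pow n, A_pow (Suc n)]
      else if even (n + j) then [A_pow (1 + 2 * multiplicity 2 (Suc j))]
      else [D_pow (1 + 2 * multiplicity 2 (Suc j))])"

text \<open>The parameters of \<open>sb_move\<close> are forced: the depth fixes \<open>n\<close>,
  the position fixes \<open>k\<close>, and the multiplicity of 2 in \<open>k\<close> fixes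
  \<open>p\<close>.\<close>

lemma sb_move_iff:
  assumes "j < 2 ^ n"
  shows "sb_move (2 ^ n + j) w \<longleftrightarrow> w = move_word n j"
proof
  assume "sb_move (2 ^ n + j) w"
  then show "w = move_word n j"
  proof cases
    case (rightmost_even n')
    then show ?thesis using depth_sb_elem[OF assms] assms by (auto simp: move_word_def)
  next
    case (rightmost_odd n')
    then show ?thesis using depth_sb_elem[OF assms] assms by (auto simp: move_word_def)
  next
    case (inner_cong n' k p)
    then have n': "n' = Suc n" using depth_sb_elem[OF assms] by simp
    then have k: "k = Suc j" using inner_cong by simp
    obtain v where p: "p = Suc v" using inner_cong by (cases p) auto
    have "[Suc j = 2 ^ v] (mod 2 ^ Suc v)" using inner_cong(9) unfolding k p by simp
    then have "multiplicity 2 (Suc j) = v"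
      using multiplicity_2_eq_iff_cong[of "Suc j" v] by blast
    moreover have "Suc j \<noteq> 2 ^ n" using inner_cong(6) n' k by simp
    ultimately show ?thesis using inner_cong(1,10) Suc_cong_mod_2_iff
      unfolding n' k p by (simp add: move_word_def)
  next
    case (inner_not_cong n' k p)
    then have n': "n' = Suc n" using depth_sb_elem[OF assms] by simp
    then have k: "k = Suc j" using inner_not_cong by simp
    obtain v where p: "p = Suc v" using inner_not_cong by (cases p) auto
    have "[Suc j = 2 ^ v] (mod 2 ^ Suc v)" using inner_not_cong(9) unfolding k p by simp
    then have "multiplicity 2 (Suc j) = v"
      using multiplicity_2_eq_iff_cong[of "Suc j" v] by blast
    moreover have "Suc j \<noteq> 2 ^ n" using inner_not_cong(6) n' k by simp
    ultimately show ?thesis using inner_not_cong(1,10) Suc_cong_mod_2_iff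
      unfolding n' k p by (simp add: move_word_def)
  qed
next
  assume w: "w = move_word n j"
  show "sb_move (2 ^ n + j) w"
  proof (cases "Suc j = 2 ^ n")
    case True
    then have m: "2 ^ n + j = 2 ^ Suc n - 1" by simp
    have m1: "1 \<le> 2 ^ n + j" using one_le_power[of "2::nat" n] by linarith
    show ?thesis
      using rightmost_even[OF m1 depth_sb_elem[OF assms] m] rightmost_odd[OF m1 depth_sb_elem[OF assms] m] True
      by (simp add: w move_word_def)
  next
    case False
    define v where "v = multiplicity 2 (Suc j)"
    have less: "Suc j < 2 ^ n" using assms False by simp
    \<comment> \<open>This is the source of the bound \<open>p \<le> n - 1\<close> in the
      rule.\<close>
    have "2 ^ v \<le> Suc j" unfolding v_def by (intro dvd_imp_le multiplicity_dvd) simp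
    then have "(2::nat) ^ v < 2 ^ n" using less by linarith
    then have "v < n" by simp
    moreover have "[Suc j = 2 ^ v] (mod 2 ^ Suc v)"
      by (subst multiplicity_2_eq_iff_cong) (simp_all add: v_def)
    ultimately have pre: "1 \<le> 2 ^ n + j" "2 ^ n + j = 2 ^ (Suc n - 1) + (Suc j - 1)" "1 \<le> Suc j"
      "Suc j < 2 ^ (Suc n - 1)" "1 \<le> Suc v" "Suc v \<le> Suc n - 1"
      "[Suc j = 2 ^ (Suc v - 1)] (mod 2 ^ Suc v)"
      using less by simp_all
    show ?thesis
      using sb_move.inner_cong[OF pre(1) depth_sb_elem[OF assms] pre(2-7)]
        sb_move.inner_not_cong[OF pre(1) depth_sb_elem[OF assms] pre(2-7)] False
      unfolding Suc_cong_mod_2_iff by (simp add: w move_word_def v_def)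
  qed
qed

lemma sb_word_eq:
  assumes "j < 2 ^ n"
  shows "sb_word (2 ^ n + j) = move_word n j"
  unfolding sb_word_def sb_move_iff[OF assms] by simp

section \<open>Following \<open>g\<close> through the tree\<close>

text \<open>After the root, \<open>g\<^sub>m\<close> is \<open>X R\<close> up to sign if the depth and the position in the level have
  the same parity, and \<open>X\<close> up to sign otherwise.\<close>

definition turned :: "nat \<Rightarrow> nat \<Rightarrow> bool" where
  "turned n j \<longleftrightarrow> n > 0 \<and> even (n + j)"

text \<open>With \<open>X' = X D\<^sup>t R\<^sup>-\<^sup>1\<close> for the successor,
  \<open>X D\<^sup>t = X' R\<close> and \<open>X R A\<^sup>t = X D\<^sup>t R = - X'\<close>. Each
  move thus toggles the turn, and the second kind changes the sign.\<close>

lemma move_inner: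
  assumes "Suc j < 2 ^ n" "s \<in> {1, -1}"
  shows "\<exists>s'\<in>{1, -1}. row_matrix n j ** turn (turned n j) s ** word_matrix (move_word n j) =
    row_matrix n (Suc j) ** turn (turned n (Suc j)) s'"
proof -
  have "n > 0" using assms(1) by (cases n) auto
  then show ?thesis
    using assms unfolding row_matrix_next[OF assms(1)]
    by (auto simp: turned_def turn_def move_word_def mat_1_eq_mat22 add.commute simp flip: matrix_mul_assoc
        simp del: sb_row.simps)
qed

text \<open>The right edge carries \<open>D\<^sup>-\<^sup>n\<close> and the next left edge
  \<open>A\<^sup>n\<^sup>+\<^sup>1\<close>. Up to the turn, the first factor undoes the right edge
  back to the root and the second one descends the left edge.\<close>

lemma move_rightmost:
  assumes "s \<in> {1, -1}"
  shows "\<exists>s'\<in>{1, -1}. row_matrix n (2 ^ n - 1) ** turn (turned n (2 ^ n - 1)) s **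
      word_matrix (move_word n (2 ^ n - 1)) =
    row_matrix (Suc n) 0 ** turn (turned (Suc n) 0) s'"
proof -
  have "Suc (2 ^ n - 1) = 2 ^ n" by simp
  \<comment> \<open>For \<open>n > 0\<close> the position \<open>2 ^ n - 1\<close> is odd; for
    \<open>n = 0\<close> the clause \<open>n > 0\<close> in \<open>turned\<close> makes both sides
    false.\<close>
  moreover have "turned n (2 ^ n - 1) \<longleftrightarrow> odd n" by (cases n) (auto simp: turned_def)
  ultimately show ?thesis
    using assms unfolding row_matrix_leftmost row_matrix_rightmost
    by (auto simp: turned_def turn_def move_word_def mat_1_eq_mat22 algebra_simps simp del: sb_row.simps)
qed

theorem theorem5p2:
  fixes g :: "nat \<Rightarrow> real^2^2"
  assumes "g 1 = mat 1"
    and "\<And>m. m \<ge> 1 \<Longrightarrow> g (m + 1) = g m ** word_matrix (sb_word m)"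
  shows "\<forall>m\<ge>1.
      (\<exists>!w. sb_move m w) \<and>
      Im (base_point (g m)) > 0 \<and>
      base_point (g m) = base_point (sb_matrix (sb_elem m)) \<and>
      (\<forall>u f v. sb_word m = u @ f # v \<and> factor_time f > 0 \<longrightarrow>
         clockwise_along_ford_circle
           (\<lambda>s. base_point (factor_flow f s (g m ** word_matrix u))) (real (factor_time f)))"
proof (intro allI impI)
  fix m :: nat assume "m \<ge> 1"
  \<comment> \<open>The second part of the invariant locates the base point; integrality is carried
    along for the upper half-plane and the clockwise motion.\<close>
  then have "integral_sl2 (g m) \<and> (\<exists>n j s. m = 2 ^ n + j \<and> j < 2 ^ n \<and> s \<in> {1, -1} \<and>
      g m = row_matrix n j ** turn (turned n j) s)"
  proof (induction m rule: nat_induct_at_least)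
    case base
    have "(1::nat) = 2 ^ 0 + 0 \<and> (0::nat) < 2 ^ 0 \<and> (1::real) \<in> {1, -1} \<and>
        g 1 = row_matrix 0 0 ** turn (turned 0 0) 1"
      unfolding assms(1) row_matrix_0 by (simp add: turned_def turn_def mat_1_eq_mat22)
    then show ?case using assms(1) integral_sl2_one by metis
  next
    case (Suc m)
    then obtain n j s where IH: "m = 2 ^ n + j" "j < 2 ^ n" "s \<in> {1, -1}"
      "g m = row_matrix n j ** turn (turned n j) s" by blast
    have g: "g (Suc m) = g m ** word_matrix (move_word n j)"
      using assms(2)[OF Suc.hyps] IH by (simp add: sb_word_eq)
    have "\<exists>n j s. Suc m = 2 ^ n + j \<and> j < 2 ^ n \<and> s \<in> {1, -1} \<and>
      g (Suc m) = row_matrix n j ** turn (turned n j) s"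
    proof (cases "Suc j = 2 ^ n")
      case True
      then have j: "j = 2 ^ n - 1" by simp
      obtain s' where "s' \<in> {1, -1}" "g (Suc m) = row_matrix (Suc n) 0 ** turn (turned (Suc n) 0) s'"
        using move_rightmost[OF IH(3), of n] unfolding g IH(4) j by blast
      moreover have "Suc m = 2 ^ Suc n + 0" "(0::nat) < 2 ^ Suc n" using True IH(1) by simp_all
      ultimately show ?thesis by blast
    next
      case False
      then have less: "Suc j < 2 ^ n" using IH(2) by simp
      obtain s' where "s' \<in> {1, -1}" "g (Suc m) = row_matrix n (Suc j) ** turn (turned n (Suc j)) s'"
        using move_inner[OF less IH(3)] unfolding g IH(4) by blast
      moreover have "Suc m = 2 ^ n + Suc j" using IH(1) by simp
      ultimately show ?thesis using less by blast
    qed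
    moreover have "integral_sl2 (g (Suc m))"
      unfolding g using Suc.IH by (blast intro: integral_sl2_mult integral_sl2_word_matrix)
    ultimately show ?case by blast
  qed
  then obtain n j s where int: "integral_sl2 (g m)" and m: "m = 2 ^ n + j" "j < 2 ^ n"
    and s: "s \<in> {1, -1}" and g: "g m = row_matrix n j ** turn (turned n j) s" by blast
  have "\<exists>!w. sb_move m w"
    unfolding m(1) sb_move_iff[OF m(2)] by simp
  moreover have "base_point (g m) = base_point (sb_matrix (sb_elem m))"
    using base_point_turn[of s "row_matrix n j"] s sb_matrix_sb_elem[OF m(2)] unfolding g m(1)[symmetric]
    by auto
  \<comment> \<open>The prefix \<open>u\<close> may be any word, since
    \<open>g m ** word_matrix u\<close> remains integral of determinant 1.\<close>
  moreover have "clockwise_along_ford_circle (\<lambda>s. base_point (factor_flow f s (g m ** word_matrix u))) T"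
    for u f T
    using int by (intro factor_flow_clockwise integral_sl2_mult integral_sl2_word_matrix)
  ultimately show "(\<exists>!w. sb_move m w) \<and>
      Im (base_point (g m)) > 0 \<and>
      base_point (g m) = base_point (sb_matrix (sb_elem m)) \<and>
      (\<forall>u f v. sb_word m = u @ f # v \<and> factor_time f > 0 \<longrightarrow>
         clockwise_along_ford_circle
           (\<lambda>s. base_point (factor_flow f s (g m ** word_matrix u))) (real (factor_time f)))"
    using Im_base_point_pos[OF int] by blast
qed

end
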